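(* Assume the observed data distribution $p(Y,Z)$ is induced by a structural causal model of a DAG $\mathcal{G}$ with vertex set $\{Y\} \cup Z$, where $Z = \{X, A, M\}$ consists of pre-treatment variables $X$, a binary treatment $A \in \{0,1\}$, and post-treatment pre-outcome mediators $M$, and $Y$ is the outcome. Let $\pi$ be a set of proper causal paths from $A$ to $Y$ in $\mathcal{G}$ that includes the direct edge $A \to Y$. For a treatment value $a \in \{0,1\}$ and a reference value $a' \in \{0,1\}$, let $p(Y(\pi,a,a'))$ be the potential outcome distribution corresponding to the effect of $A$ on $Y$ along the paths in $\pi$, assumed to be identified by the edge g-formula. Let $p(Y_0(\pi,a,a'))$ denote the identifying functional for $p(Y(\pi,a,a'))$ obtained from the edge g-formula, in which the term $p(Y \mid Z)$ is evaluated at $\{Z \setminus A\} = 0$. Then $\mathbb{E}[Y \mid Z]$ can be written as $$\mathbb{E}[Y \mid Z] = f(Z) - \big(\mathbb{E}[Y(\pi,a,a')] - \mathbb{E}[Y_0(\pi,a,a')]\big) + \phi(A),$$ where in the parenthesized term $a$ is taken to be the value of $A$ in $Z$ and the reference value $a'$ is held fixed, $f(Z) := \mathbb{E}[Y \mid Z] - \mathbb{E}[Y \mid A, \{Z\setminus A\} = 0]$, and $\phi(A) = w_0 + w_a A$ for real constants $w_0, w_a$. Furthermore, $w_a$ equals the $\pi$-specific effect of $A$ on $Y$, that is, $w_a = \mathbb{E}[Y(\pi,1,a')] - \mathbb{E}[Y(\pi,0,a')]$.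
   Context: **Causal model.** $\mathrm{pa}_{\mathcal G}(V_i)$ denotes the parents of $V_i$ in the DAG $\mathcal G$ with vertex set $V=\{Y\}\cup Z$; $X$ and $M$ may be sets of variables; pre-treatment variables are not descendants of $A$, and $Y$ is not an ancestor of any variable in $Z$. For each $V_i\in V$ and each value $v$ of $\mathrm{pa}_{\mathcal G}(V_i)$ there is a potential outcome $V_i(v)$. In the structural causal model of $\mathcal G$, the families $\{V_i(v) : v\}$, for $V_i$ ranging over $V$, are mutually independent (equivalently, nonparametric structural equations with independent errors). The potential outcome $V_i(a')$ under setting $A=a'$ is defined by recursive substitution: $V_i(a')$ is $V_i$ evaluated with $A$ set to $a'$ (if $A$ is a parent of $V_i$) and every other parent $V_j$ set to $V_j(a')$. The observed variables are obtained by recursive substitution with no intervention, so that $p(V)=\prod_{V_i \in V} p(V_i\mid \mathrm{pa}_{\mathcal G}(V_i))$. **Path-specific potential outcomes.** A proper causal path from $A$ is a directed path that meets $A$ only at its source. Given a set $\pi$ of proper causal paths from $A$ to $Y$, let $\mathrm{pa}^{\pi}_{\mathcal G}(V_i)$ be the set of parents of $V_i$ along an edge that is part of a path in $\pi$, and $\mathrm{pa}^{\overline{\pi}}_{\mathcal G}(V_i)$ the set of all other parents of $V_i$. Define $V_i(\pi,a,a') := a$ if $V_i$ is $A$, and otherwise $$V_i(\pi,a,a') := V_i\big(\{V_j(\pi,a,a') : V_j \in \mathrm{pa}^{\pi}_{\mathcal G}(V_i)\},\ \{V_j(a') : V_j \in \mathrm{pa}^{\overline{\pi}}_{\mathcal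 G}(V_i)\}\big),$$ where $V_j(a') := a'$ if $V_j$ is $A$. **Edge g-formula and standing identification assumption.** It is assumed that $\pi$ is such that $Y(\pi,a,a')$ is edge-consistent, i.e. no variable $V_j$ occurs in the nested counterfactual $Y(\pi,a,a')$ both with the value of $A$ along the edge $A\to V_j$ set to $a$ and with it set to $a'$. In that case the distribution of $Y(\pi,a,a')$ is identified by the edge g-formula $$p(Y(\pi,a,a')) = \sum_{V\setminus\{A,Y\}} \ \prod_{V_i\in V\setminus\{A\}} p\big(V_i \mid a \cap \mathrm{pa}^{\pi}_{\mathcal G}(V_i),\ a'\cap \mathrm{pa}^{\overline{\pi}}_{\mathcal G}(V_i),\ \mathrm{pa}_{\mathcal G}(V_i)\setminus A\big),$$ that is, in the factor for $V_i$, if $A$ is a parent of $V_i$ then $A$ is set to $a$ when the edge $A\to V_i$ is part of a path in $\pi$ and to $a'$ otherwise. (Sums are replaced by integrals for continuous variables.) Since $A\to Y$ is in $\pi$, the factor for $Y$ is $p(Y\mid Z)$ with $A=a$. **The functional $Y_0$.** $p(Y_0(\pi,a,a'))$ is the right-hand side of the edge g-formula with the factor $p(Y\mid A=a, Z\setminus A)$ replaced by $p(Y\mid A=a,\{Z\setminus A\}=0)$ (all other factors unchanged), and $\mathbb{E}[Y_0(\pi,a,a')]$ is the corresponding mean. Here $0$ is a reference value in the state space of $Z\setminus A$. All conditional distributions and expectations that appear are assumed to be well defined and finite. *)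

theory Defs
  imports "HOL-Probability.Probability"
begin

section \<open>Structural causal models\<close>

text \<open>
  The vertices are the elements of a finite type. The measure \<open>state C i\<close> is both the
  state space of \<open>V\<^sub>i\<close> and the measure with respect to which densities are taken: counting
  measure for a discrete variable, Lebesgue measure for a continuous one. All conditional
  distributions below are conditional densities, so one integral covers sums and integrals.
\<close>

record ('i, 'v, 'e, 'w) causal_model =
  edges :: "('i \<times> 'i) set"
  state :: "'i \<Rightarrow> 'v measure"
  err_space :: "'i \<Rightarrow> 'e measure"
  mech :: "'i \<Rightarrow> ('i \<Rightarrow> 'v) \<Rightarrow> 'e \<Rightarrow> 'v"
  prob :: "'w measure"
  err :: "'i \<Rightarrow> 'w \<Rightarrow> 'e"

definition pa :: "('i, 'v, 'e, 'w) causal_model \<Rightarrow> 'i \<Rightarrow> 'i set" where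
  "pa C i = {j. (j, i) \<in> edges C}"

definition scm :: "('i::finite, 'v, 'e, 'w) causal_model \<Rightarrow> bool" where
  "scm C \<longleftrightarrow>
     acyclic (edges C) \<and>
     prob_space (prob C) \<and>
     (\<forall>i. sigma_finite_measure (state C i)) \<and>
     (\<forall>i. case_prod (mech C i) \<in>
            (PiM (pa C i) (state C) \<Otimes>\<^sub>M err_space C i) \<rightarrow>\<^sub>M state C i) \<and>
     prob_space.indep_vars (prob C) (err_space C) (err C) UNIV"

text \<open>The potential outcome \<open>V\<^sub>i(v)\<close>; only the coordinates of \<open>v\<close> in \<open>pa C i\<close> matter.\<close>

definition pot :: "('i, 'v, 'e, 'w) causal_model \<Rightarrow> 'i \<Rightarrow> ('i \<Rightarrow> 'v) \<Rightarrow> 'w \<Rightarrow> 'v" where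
  "pot C i v \<omega> = mech C i (restrict v (pa C i)) (err C i \<omega>)"

text \<open>Recursive substitution is well-founded recursion along the edges; the recursion
  equations are the lemmas \<open>observed_rec\<close>, \<open>intervened_rec\<close> and \<open>path_outcome_rec\<close>.\<close>

definition observed :: "('i, 'v, 'e, 'w) causal_model \<Rightarrow> 'w \<Rightarrow> 'i \<Rightarrow> 'v" where
  "observed C \<omega> = wfrec (edges C) (\<lambda>V i. pot C i V \<omega>)"

definition intervened ::
  "('i, 'v, 'e, 'w) causal_model \<Rightarrow> 'i \<Rightarrow> 'v \<Rightarrow> 'w \<Rightarrow> 'i \<Rightarrow> 'v" where
  "intervened C A a' \<omega> = wfrec (edges C) (\<lambda>V i. if i = A then a' else pot C i V \<omega>)"


section \<open>Path-specific potential outcomes\<close>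

definition proper_causal_path :: "('i \<times> 'i) set \<Rightarrow> 'i \<Rightarrow> 'i \<Rightarrow> 'i list \<Rightarrow> bool" where
  "proper_causal_path E A Y q \<longleftrightarrow>
     q \<noteq> [] \<and> hd q = A \<and> last q = Y \<and> A \<notin> set (tl q) \<and>
     successively (\<lambda>u v. (u, v) \<in> E) q"

definition path_edges :: "'i list set \<Rightarrow> ('i \<times> 'i) set" where
  "path_edges \<pi> = {(u, v). \<exists>xs ys. xs @ u # v # ys \<in> \<pi>}"

definition path_outcome ::
  "('i, 'v, 'e, 'w) causal_model \<Rightarrow> 'i list set \<Rightarrow> 'i \<Rightarrow> 'v \<Rightarrow> 'v \<Rightarrow> 'w \<Rightarrow> 'i \<Rightarrow> 'v" where
  "path_outcome C \<pi> A a a' \<omega> =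
     wfrec (edges C) (\<lambda>V i. if i = A then a
       else pot C i (\<lambda>j. if (j, i) \<in> path_edges \<pi> then V j
                         else intervened C A a' \<omega> j) \<omega>)"

text \<open>
  The variables occurring in the nested counterfactual \<open>Y(\<pi>,a,a')\<close>: \<open>occurs E \<pi> A Y True i\<close>
  says that it contains \<open>V\<^sub>i(\<pi>,a,a')\<close>, and \<open>occurs E \<pi> A Y False i\<close> that it contains
  \<open>V\<^sub>i(a')\<close>. The treatment is not unfolded any further.
\<close>

inductive occurs :: "('i \<times> 'i) set \<Rightarrow> 'i list set \<Rightarrow> 'i \<Rightarrow> 'i \<Rightarrow> bool \<Rightarrow> 'i \<Rightarrow> bool"
  for E \<pi> A Y where
  outcome: "occurs E \<pi> A Y True Y"
| on_path: "\<lbrakk>occurs E \<pi> A Y True i; i \<noteq> A; (j, i) \<in> E; (j, i) \<in> path_edges \<pi>\<rbrakk>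
    \<Longrightarrow> occurs E \<pi> A Y True j"
| off_path: "\<lbrakk>occurs E \<pi> A Y True i; i \<noteq> A; (j, i) \<in> E; (j, i) \<notin> path_edges \<pi>\<rbrakk>
    \<Longrightarrow> occurs E \<pi> A Y False j"
| baseline: "\<lbrakk>occurs E \<pi> A Y False i; i \<noteq> A; (j, i) \<in> E\<rbrakk> \<Longrightarrow> occurs E \<pi> A Y False j"

text \<open>
  In an occurrence of \<open>V\<^sub>i(\<pi>,a,a')\<close> the edge from the treatment to \<open>V\<^sub>i\<close> carries \<open>a\<close> if it is
  an edge of \<open>\<pi>\<close> and \<open>a'\<close> otherwise; in an occurrence of \<open>V\<^sub>i(a')\<close> it carries \<open>a'\<close>.
\<close>

definition edge_consistent :: "('i \<times> 'i) set \<Rightarrow> 'i list set \<Rightarrow> 'i \<Rightarrow> 'i \<Rightarrow> bool" where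
  "edge_consistent E \<pi> A Y \<longleftrightarrow>
     \<not> (\<exists>i. i \<noteq> A \<and> (A, i) \<in> E \<and>
            (occurs E \<pi> A Y True i \<and> (A, i) \<in> path_edges \<pi>) \<and>
            (occurs E \<pi> A Y True i \<and> (A, i) \<notin> path_edges \<pi> \<or> occurs E \<pi> A Y False i))"


section \<open>Conditional densities\<close>

text \<open>Here \<open>p\<close> is a density of the joint distribution of all variables. The marginal density
  \<open>p(v\<^sub>I)\<close> only depends on the coordinates of \<open>v\<close> in \<open>I\<close>.\<close>

definition marginal ::
  "('i \<Rightarrow> 'v measure) \<Rightarrow> (('i \<Rightarrow> 'v) \<Rightarrow> ennreal) \<Rightarrow> 'i set \<Rightarrow> ('i \<Rightarrow> 'v) \<Rightarrow> ennreal" where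
  "marginal S p I v = (\<integral>\<^sup>+ x. p (merge I (- I) (v, x)) \<partial>PiM (- I) S)"

definition cond_dens ::
  "('i \<Rightarrow> 'v measure) \<Rightarrow> (('i \<Rightarrow> 'v) \<Rightarrow> ennreal) \<Rightarrow> 'i \<Rightarrow> 'i set \<Rightarrow> ('i \<Rightarrow> 'v) \<Rightarrow> ennreal" where
  "cond_dens S p i I v = marginal S p (insert i I) v / marginal S p I v"

definition cond_defined ::
  "('i \<Rightarrow> 'v measure) \<Rightarrow> (('i \<Rightarrow> 'v) \<Rightarrow> ennreal) \<Rightarrow> 'i set \<Rightarrow> ('i \<Rightarrow> 'v) \<Rightarrow> bool" where
  "cond_defined S p I v \<longleftrightarrow> 0 < marginal S p I v \<and> marginal S p I v < \<infinity>"

text \<open>The conditional distribution of the outcome given \<open>Z = z\<close>, where \<open>Z\<close> consists of all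
  variables but the outcome. The function \<open>yv\<close> gives the real value of the outcome.\<close>

definition outcome_cond ::
  "('i \<Rightarrow> 'v measure) \<Rightarrow> (('i \<Rightarrow> 'v) \<Rightarrow> ennreal) \<Rightarrow> 'i \<Rightarrow> ('i \<Rightarrow> 'v) \<Rightarrow> 'v measure" where
  "outcome_cond S p Y z = density (S Y) (\<lambda>y. cond_dens S p Y (- {Y}) (z(Y := y)))"

definition cond_mean ::
  "('i \<Rightarrow> 'v measure) \<Rightarrow> (('i \<Rightarrow> 'v) \<Rightarrow> ennreal) \<Rightarrow> 'i \<Rightarrow> ('v \<Rightarrow> real) \<Rightarrow> ('i \<Rightarrow> 'v) \<Rightarrow> real" where
  "cond_mean S p Y yv z = (\<integral>y. yv y \<partial>outcome_cond S p Y z)"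

definition cond_mean_defined ::
  "('i \<Rightarrow> 'v measure) \<Rightarrow> (('i \<Rightarrow> 'v) \<Rightarrow> ennreal) \<Rightarrow> 'i \<Rightarrow> ('v \<Rightarrow> real) \<Rightarrow> ('i \<Rightarrow> 'v) \<Rightarrow> bool" where
  "cond_mean_defined S p Y yv z \<longleftrightarrow>
     cond_defined S p (- {Y}) z \<and> integrable (outcome_cond S p Y z) yv"


section \<open>The edge g-formula\<close>

text \<open>The conditioning value for the factor of \<open>V\<^sub>i\<close>: the treatment is set to \<open>a\<close> if the edge
  from it to \<open>V\<^sub>i\<close> is part of a path in \<open>\<pi>\<close>, and to \<open>a'\<close> otherwise. If the treatment is not a
  parent of \<open>V\<^sub>i\<close>, this has no effect on the factor.\<close>

definition edge_setting ::
  "'i list set \<Rightarrow> 'i \<Rightarrow> 'v \<Rightarrow> 'v \<Rightarrow> 'i \<Rightarrow> ('i \<Rightarrow> 'v) \<Rightarrow> 'i \<Rightarrow> 'v" where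
  "edge_setting \<pi> A a a' i v = v(A := if (A, i) \<in> path_edges \<pi> then a else a')"

definition edge_factor ::
  "('i, 'v, 'e, 'w) causal_model \<Rightarrow> (('i \<Rightarrow> 'v) \<Rightarrow> ennreal) \<Rightarrow> 'i list set \<Rightarrow> 'i \<Rightarrow> 'v \<Rightarrow> 'v \<Rightarrow>
   'i \<Rightarrow> ('i \<Rightarrow> 'v) \<Rightarrow> ennreal" where
  "edge_factor C p \<pi> A a a' i v =
     cond_dens (state C) p i (pa C i) (edge_setting \<pi> A a a' i v)"

definition g_formula ::
  "('i::finite \<Rightarrow> 'v measure) \<Rightarrow> 'i \<Rightarrow> 'i \<Rightarrow> ('i \<Rightarrow> ('i \<Rightarrow> 'v) \<Rightarrow> ennreal) \<Rightarrow> 'v \<Rightarrow> ennreal" where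
  "g_formula S A Y fac y =
     (\<integral>\<^sup>+ x. (\<Prod>i\<in>- {A}. fac i (x(Y := y))) \<partial>PiM (- {A, Y}) S)"

definition edge_g ::
  "('i::finite, 'v, 'e, 'w) causal_model \<Rightarrow> (('i \<Rightarrow> 'v) \<Rightarrow> ennreal) \<Rightarrow> 'i list set \<Rightarrow> 'i \<Rightarrow> 'i \<Rightarrow>
   'v \<Rightarrow> 'v \<Rightarrow> 'v \<Rightarrow> ennreal" where
  "edge_g C p \<pi> A Y a a' = g_formula (state C) A Y (edge_factor C p \<pi> A a a')"

text \<open>The factor of the outcome is replaced by its conditional density given that the treatment
  is \<open>a\<close> and all other variables of \<open>Z\<close> have the reference value \<open>z0\<close>.\<close>

definition edge_g0 ::
  "('i::finite, 'v, 'e, 'w) causal_model \<Rightarrow> (('i \<Rightarrow> 'v) \<Rightarrow> ennreal) \<Rightarrow> 'i list set \<Rightarrow> 'i \<Rightarrow> 'i \<Rightarrow>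
   ('i \<Rightarrow> 'v) \<Rightarrow> 'v \<Rightarrow> 'v \<Rightarrow> 'v \<Rightarrow> ennreal" where
  "edge_g0 C p \<pi> A Y z0 a a' = g_formula (state C) A Y
     ((edge_factor C p \<pi> A a a')
        (Y := \<lambda>v. cond_dens (state C) p Y (- {Y}) (z0(A := a, Y := v Y))))"

text \<open>
  Positivity: the factor of \<open>V\<^sub>i\<close> has to be defined wherever none of the factors of the
  ancestors of \<open>V\<^sub>i\<close> vanishes. Elsewhere the integrand of the edge g-formula is zero.
\<close>

definition edge_factors_defined ::
  "('i::finite, 'v, 'e, 'w) causal_model \<Rightarrow> (('i \<Rightarrow> 'v) \<Rightarrow> ennreal) \<Rightarrow> 'i list set \<Rightarrow> 'i \<Rightarrow> 'i \<Rightarrow>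
   'v \<Rightarrow> 'v \<Rightarrow> bool" where
  "edge_factors_defined C p \<pi> A Y a a' \<longleftrightarrow>
     (\<forall>x \<in> space (PiM (- {A, Y}) (state C)). \<forall>i \<in> - {A}.
        (\<forall>j \<in> - {A}. (j, i) \<in> (edges C)\<^sup>+ \<longrightarrow> edge_factor C p \<pi> A a a' j x \<noteq> 0) \<longrightarrow>
        cond_defined (state C) p (pa C i) (edge_setting \<pi> A a a' i x))"

definition path_mean ::
  "('i, 'v, 'e, 'w) causal_model \<Rightarrow> 'i list set \<Rightarrow> 'i \<Rightarrow> 'i \<Rightarrow> ('v \<Rightarrow> real) \<Rightarrow> 'v \<Rightarrow> 'v \<Rightarrow> real" where
  "path_mean C \<pi> A Y yv a a' = (\<integral>\<omega>. yv (path_outcome C \<pi> A a a' \<omega> Y) \<partial>prob C)"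

definition path_mean0 ::
  "('i::finite, 'v, 'e, 'w) causal_model \<Rightarrow> (('i \<Rightarrow> 'v) \<Rightarrow> ennreal) \<Rightarrow> 'i list set \<Rightarrow> 'i \<Rightarrow> 'i \<Rightarrow>
   ('v \<Rightarrow> real) \<Rightarrow> ('i \<Rightarrow> 'v) \<Rightarrow> 'v \<Rightarrow> 'v \<Rightarrow> real" where
  "path_mean0 C p \<pi> A Y yv z0 a a' =
     (\<integral>y. yv y \<partial>density (state C Y) (edge_g0 C p \<pi> A Y z0 a a'))"


section \<open>Recursion equations\<close>

lemma pot_cong: "(\<And>j. (j, i) \<in> edges C \<Longrightarrow> v j = v' j) \<Longrightarrow> pot C i v \<omega> = pot C i v' \<omega>"
  unfolding pot_def pa_def by (metis (no_types, lifting) mem_Collect_eq restrict_ext)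

lemma scm_wf: "scm C \<Longrightarrow> wf (edges C)"
  unfolding scm_def by (simp add: finite_acyclic_wf)

lemma observed_rec:
  assumes "scm C"
  shows "observed C \<omega> i = pot C i (observed C \<omega>) \<omega>"
  unfolding observed_def
  by (subst wfrec[OF scm_wf[OF assms]]) (rule pot_cong, simp add: cut_apply)

lemma intervened_rec:
  assumes "scm C"
  shows "intervened C A a' \<omega> i = (if i = A then a' else pot C i (intervened C A a' \<omega>) \<omega>)"
  unfolding intervened_def
  by (subst wfrec[OF scm_wf[OF assms]]) (auto intro!: pot_cong simp: cut_apply)

lemma path_outcome_rec:
  assumes "scm C"
  shows "path_outcome C \<pi> A a a' \<omega> i = (if i = A then a
    else pot C i (\<lambda>j. if (j, i) \<in> path_edges \<pi> then path_outcome C \<pi> A a a' \<omega> j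
                      else intervened C A a' \<omega> j) \<omega>)"
  unfolding path_outcome_def
  by (subst wfrec[OF scm_wf[OF assms]]) (auto intro!: pot_cong simp: cut_apply)

end

theory Submission
  imports Defs
begin

text \<open>
  Since \<open>Y\<close> is not an ancestor of any other variable, only its own factor in the edge g-formula
  depends on the value of \<open>Y\<close>. The remaining factors form a weight on \<open>Z \<setminus> A\<close>. The conditional
  density of \<open>Y\<close> integrates to one wherever the weight is not zero, so the total mass of the
  weight is that of the edge g-formula, which is one because the latter is the density of
  \<open>Y(\<pi>,a,a')\<close>. Hence replacing the factor of \<open>Y\<close> by one that does not depend on \<open>Z \<setminus> A\<close> yields
  \<open>E[Y\<^sub>0(\<pi>,a,a')] = E[Y | A = a, Z \<setminus> A = 0]\<close>, and the claimed decomposition says that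
  \<open>w\<^sub>0 + w\<^sub>a a = E[Y(\<pi>,a,a')]\<close> for both values of \<open>a\<close>.
\<close>

section \<open>Marginal and conditional densities\<close>

lemma marginal_cong:
  assumes "\<And>i. i \<in> I \<Longrightarrow> v i = v' i"
  shows "marginal S p I v = marginal S p I v'"
proof -
  have "merge I (- I) (v, x) = merge I (- I) (v', x)" for x
    using assms by (auto simp: merge_def fun_eq_iff)
  then show ?thesis by (simp add: marginal_def)
qed

lemma cond_dens_cong:
  assumes "\<And>j. j \<in> insert i I \<Longrightarrow> v j = v' j"
  shows "cond_dens S p i I v = cond_dens S p i I v'"
  unfolding cond_dens_def
  using assms marginal_cong[of "insert i I" v v'] marginal_cong[of I v v'] by simp

lemma merge_restrict_eq: "merge I J (restrict v I, x) = merge I J (v, x)"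
  by (auto simp: merge_def fun_eq_iff)

lemma borel_measurable_marginal:
  fixes S :: "'i::finite \<Rightarrow> 'v measure"
  assumes "\<And>i. sigma_finite_measure (S i)"
    and p: "p \<in> borel_measurable (PiM UNIV S)"
  shows "marginal S p I \<in> borel_measurable (PiM UNIV S)"
proof -
  interpret product_sigma_finite S by (rule product_sigma_finite.intro) (rule assms(1))
  interpret N: sigma_finite_measure "PiM (- I) S" by (rule sigma_finite) simp
  \<comment> \<open>A point of the full product is first cut down to \<open>I\<close>, because
    \<open>measurable_merge\<close> expects a point of the product over \<open>I\<close>; by
    \<open>merge_restrict_eq\<close> the merged point stays the same.\<close>
  have "(\<lambda>w. merge I (- I) (restrict (fst w) I, snd w))
      \<in> (PiM UNIV S \<Otimes>\<^sub>M PiM (- I) S) \<rightarrow>\<^sub>M PiM (I \<union> - I) S"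
    by (rule measurable_compose[OF _ measurable_merge])
      (auto intro!: measurable_Pair measurable_compose[OF measurable_fst measurable_restrict_subset])
  then have "(\<lambda>(v, x). p (merge I (- I) (v, x))) \<in> borel_measurable (PiM UNIV S \<Otimes>\<^sub>M PiM (- I) S)"
    using p by (auto simp: merge_restrict_eq split_def intro: measurable_compose)
  then show ?thesis
    unfolding marginal_def by (rule N.borel_measurable_nn_integral)
qed

text \<open>Tonelli: the coordinates outside \<open>I\<close> are \<open>i\<close> together with
  those outside \<open>insert i I\<close>, so integrating over \<open>i\<close> completes the
  integral over \<open>- I\<close>. The condition on \<open>v\<close> concerns \<open>I\<close>
  only, as all other coordinates are overwritten or ignored.\<close>

lemma nn_integral_marginal_insert:
  fixes S :: "'i::finite \<Rightarrow> 'v measure"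
  assumes "\<And>i. sigma_finite_measure (S i)"
    and p: "p \<in> borel_measurable (PiM UNIV S)"
    and "i \<notin> I" and v: "restrict v I \<in> space (PiM I S)"
  shows "(\<integral>\<^sup>+ y. marginal S p (insert i I) (v(i := y)) \<partial>S i) = marginal S p I v"
proof -
  interpret product_sigma_finite S by (rule product_sigma_finite.intro) (rule assms(1))
  let ?J = "- insert i I"
  have J: "- I = insert i ?J" using \<open>i \<notin> I\<close> by auto
  have "(\<lambda>x. merge I (- I) (restrict v I, x)) \<in> PiM (- I) S \<rightarrow>\<^sub>M PiM (I \<union> - I) S"
    by (rule measurable_compose[OF measurable_Pair1'[OF v] measurable_merge])
  then have meas: "(\<lambda>x. p (merge I (- I) (v, x))) \<in> borel_measurable (PiM (insert i ?J) S)"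
    using p unfolding J[symmetric] by (auto simp: merge_restrict_eq intro: measurable_compose)
  have "merge (insert i I) ?J (v(i := y), x) = merge I (- I) (v, x(i := y))" for x y
    using \<open>i \<notin> I\<close> by (auto simp: merge_def fun_eq_iff)
  then have "(\<integral>\<^sup>+ y. marginal S p (insert i I) (v(i := y)) \<partial>S i)
      = (\<integral>\<^sup>+ y. \<integral>\<^sup>+ x. p (merge I (- I) (v, x(i := y))) \<partial>PiM ?J S \<partial>S i)"
    by (simp add: marginal_def)
  also have "\<dots> = marginal S p I v"
    unfolding marginal_def using product_nn_integral_insert_rev[OF _ _ meas] by (simp add: J)
  finally show ?thesis .
qed

text \<open>The denominator does not involve the coordinate \<open>i\<close> and leaves the
  integral; the numerator then integrates to the same marginal, which cancels because it is neither
  zero nor infinite. The set \<open>J\<close> contains everything except possibly \<open>i\<close>,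
  so \<open>v\<close> may lack that coordinate.\<close>

lemma nn_integral_cond_dens:
  fixes S :: "'i::finite \<Rightarrow> 'v measure"
  assumes sf: "\<And>i. sigma_finite_measure (S i)"
    and p: "p \<in> borel_measurable (PiM UNIV S)"
    and i: "i \<notin> I" and v: "v \<in> space (PiM J S)" "I \<subseteq> J" "J \<union> {i} = UNIV"
    and defd: "cond_defined S p I v"
  shows "(\<integral>\<^sup>+ y. cond_dens S p i I (v(i := y)) \<partial>S i) = 1"
proof -
  have upd: "(\<lambda>y. v(i := y)) \<in> S i \<rightarrow>\<^sub>M PiM UNIV S"
    using v by (intro measurable_fun_upd[where J = J]) auto
  have "marginal S p I (v(i := y)) = marginal S p I v" for y
    using i by (intro marginal_cong) auto
  then have "(\<integral>\<^sup>+ y. cond_dens S p i I (v(i := y)) \<partial>S i)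
      = (\<integral>\<^sup>+ y. marginal S p (insert i I) (v(i := y)) / marginal S p I v \<partial>S i)"
    by (simp add: cond_dens_def)
  also have "\<dots> = (\<integral>\<^sup>+ y. marginal S p (insert i I) (v(i := y)) \<partial>S i) / marginal S p I v"
    by (rule nn_integral_divide) (rule measurable_compose[OF upd borel_measurable_marginal[OF sf p]])
  also have "\<dots> = marginal S p I v / marginal S p I v"
    using v by (subst nn_integral_marginal_insert[OF sf p i]) (auto simp: space_PiM PiE_iff)
  also have "\<dots> = 1"
    using defd by (intro ennreal_divide_self) (auto simp: cond_defined_def)
  finally show ?thesis .
qed

section \<open>Factors and weight of the edge g-formula\<close>

lemma borel_measurable_edge_factor:
  fixes C :: "('i::finite, 'v, 'e, 'w) causal_model"
  assumes sf: "\<And>i. sigma_finite_measure (state C i)"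
    and p: "p \<in> borel_measurable (PiM UNIV (state C))"
    and a: "a \<in> space (state C A)" "a' \<in> space (state C A)"
  shows "edge_factor C p \<pi> A a a' i \<in> borel_measurable (PiM (- {A}) (state C))"
proof -
  \<comment> \<open>\<open>edge_setting\<close> always writes a value at \<open>A\<close>, so it
    completes a point that lacks this coordinate.\<close>
  have "(\<lambda>v. edge_setting \<pi> A a a' i v) \<in> PiM (- {A}) (state C) \<rightarrow>\<^sub>M PiM UNIV (state C)"
    unfolding edge_setting_def using a by (intro measurable_fun_upd[where J = "- {A}"]) auto
  then show ?thesis
    unfolding edge_factor_def cond_dens_def
    by (intro borel_measurable_divide_ennreal)
      (rule measurable_compose[OF _ borel_measurable_marginal[OF sf p]], assumption)+
qed

lemma edge_factor_upd_outcome: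
  assumes "Y \<notin> pa C i" "Y \<noteq> i"
  shows "edge_factor C p \<pi> A a a' i (v(Y := y)) = edge_factor C p \<pi> A a a' i v"
  unfolding edge_factor_def edge_setting_def
  using assms by (intro cond_dens_cong) auto

definition edge_weight where
  "edge_weight C p \<pi> A Y a a' x = (\<Prod>i\<in>- {A, Y}. edge_factor C p \<pi> A a a' i x)"

lemma edge_weight_upd_outcome:
  assumes "\<And>i. i \<noteq> Y \<Longrightarrow> Y \<notin> pa C i"
  shows "edge_weight C p \<pi> A Y a a' (v(Y := y)) = edge_weight C p \<pi> A Y a a' v"
  unfolding edge_weight_def
  using assms by (intro prod.cong refl edge_factor_upd_outcome) auto

text \<open>The factors are known to be measurable over \<open>- {A}\<close>, whereas the weight is
  integrated over \<open>- {A, Y}\<close>. Inserting a fixed \<open>y\<close> at the outcome bridges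
  the gap, and the weight does not notice it.\<close>

lemma borel_measurable_edge_weight:
  fixes C :: "('i::finite, 'v, 'e, 'w) causal_model"
  assumes sf: "\<And>i. sigma_finite_measure (state C i)"
    and p: "p \<in> borel_measurable (PiM UNIV (state C))"
    and a: "a \<in> space (state C A)" "a' \<in> space (state C A)"
    and terminal: "\<And>i. i \<noteq> Y \<Longrightarrow> Y \<notin> pa C i"
    and "A \<noteq> Y" and y: "y \<in> space (state C Y)"
  shows "edge_weight C p \<pi> A Y a a' \<in> borel_measurable (PiM (- {A, Y}) (state C))"
proof -
  have "(\<lambda>x. x(Y := y)) \<in> PiM (- {A, Y}) (state C) \<rightarrow>\<^sub>M PiM (- {A}) (state C)"
    using \<open>A \<noteq> Y\<close> y by (intro measurable_fun_upd[where J = "- {A, Y}"]) auto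
  then have "(\<lambda>x. edge_weight C p \<pi> A Y a a' (x(Y := y))) \<in> borel_measurable (PiM (- {A, Y}) (state C))"
    unfolding edge_weight_def
    by (intro borel_measurable_prod_ennreal)
      (rule measurable_compose[OF _ borel_measurable_edge_factor[OF sf p a]])
  then show ?thesis by (simp add: edge_weight_upd_outcome[OF terminal])
qed

text \<open>Leaving the outcome factor \<open>h\<close> open serves both \<open>edge_g\<close>,
  where \<open>h\<close> is the edge factor of \<open>Y\<close>, and \<open>edge_g0\<close>, where
  it is evaluated at the reference value.\<close>

lemma g_formula_outcome_factor:
  fixes C :: "('i::finite, 'v, 'e, 'w) causal_model"
  assumes "A \<noteq> Y" and terminal: "\<And>i. i \<noteq> Y \<Longrightarrow> Y \<notin> pa C i"
  shows "g_formula (state C) A Y ((edge_factor C p \<pi> A a a')(Y := h)) y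
    = (\<integral>\<^sup>+ x. h (x(Y := y)) * edge_weight C p \<pi> A Y a a' x \<partial>PiM (- {A, Y}) (state C))"
proof -
  have "- {A} = insert Y (- {A, Y})" using \<open>A \<noteq> Y\<close> by auto
  then have "(\<Prod>i\<in>- {A}. ((edge_factor C p \<pi> A a a')(Y := h)) i (x(Y := y)))
      = h (x(Y := y)) * edge_weight C p \<pi> A Y a a' (x(Y := y))" for x
    by (auto simp: edge_weight_def intro!: arg_cong2[where f = "(*)"] prod.cong)
  then show ?thesis by (simp add: g_formula_def edge_weight_upd_outcome[OF terminal])
qed

section \<open>Total mass and the mean at the reference value\<close>

lemma nn_integral_edge_g:
  fixes C :: "('i::finite, 'v, 'e, 'w) causal_model"
  assumes model: "scm C"
    and p: "p \<in> borel_measurable (PiM UNIV (state C))"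
    and a: "a \<in> space (state C A)" "a' \<in> space (state C A)"
    and terminal: "\<And>i. i \<noteq> Y \<Longrightarrow> Y \<notin> pa C i"
    and "A \<noteq> Y"
    and defd: "edge_factors_defined C p \<pi> A Y a a'"
  shows "(\<integral>\<^sup>+ y. edge_g C p \<pi> A Y a a' y \<partial>state C Y)
    = (\<integral>\<^sup>+ x. edge_weight C p \<pi> A Y a a' x \<partial>PiM (- {A, Y}) (state C))"
proof -
  let ?W = "edge_weight C p \<pi> A Y a a'" and ?F = "edge_factor C p \<pi> A a a' Y"
  let ?N = "PiM (- {A, Y}) (state C)"
  have sf: "sigma_finite_measure (state C i)" for i
    using model by (simp add: scm_def)
  interpret product_sigma_finite "state C" by (rule product_sigma_finite.intro) (rule sf)
  have ins: "insert Y (- {A, Y}) = - {A}" using \<open>A \<noteq> Y\<close> by auto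
  have Ynpa: "Y \<notin> pa C Y" and Yntc: "(Y, Y) \<notin> (edges C)\<^sup>+"
    using model by (auto simp: scm_def pa_def acyclic_def)
  have W: "?W (x(Y := y)) = ?W x" for x y
    by (rule edge_weight_upd_outcome[OF terminal])
  have F: "?F \<in> borel_measurable (PiM (- {A}) (state C))"
    by (rule borel_measurable_edge_factor[OF sf p a])
  have meas: "(\<lambda>x. ?F x * ?W x) \<in> borel_measurable (PiM (insert Y (- {A, Y})) (state C))"
    unfolding edge_weight_def ins
    by (intro borel_measurable_times_ennreal borel_measurable_prod_ennreal
        borel_measurable_edge_factor[OF sf p a])
  have upd: "(\<lambda>y. x(Y := y)) \<in> state C Y \<rightarrow>\<^sub>M PiM (- {A}) (state C)" if "x \<in> space ?N" for x
    using that \<open>A \<noteq> Y\<close> by (intro measurable_fun_upd[where J = "- {A, Y}"]) auto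
  have inner: "(\<integral>\<^sup>+ y. ?F (x(Y := y)) * ?W x \<partial>state C Y) = ?W x" if x: "x \<in> space ?N" for x
  \<comment> \<open>Where the weight vanishes, the factor of \<open>Y\<close> may be undefined, but
    both sides are zero.\<close>
  proof (cases "?W x = 0")
    case False
    then have nz: "edge_factor C p \<pi> A a a' j x \<noteq> 0" if "j \<notin> {A, Y}" for j
      using that by (auto simp: edge_weight_def)
    \<comment> \<open>\<open>v\<close> has the treatment filled in but still lacks the outcome,
      whence \<open>J = - {Y}\<close> below.\<close>
    define v where "v = edge_setting \<pi> A a a' Y x"
    have "cond_defined (state C) p (pa C Y) v"
      unfolding v_def
    proof (rule defd[unfolded edge_factors_defined_def, rule_format, OF x])
      show "Y \<in> - {A}" using \<open>A \<noteq> Y\<close> by auto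
      fix j assume "j \<in> - {A}" "(j, Y) \<in> (edges C)\<^sup>+"
      \<comment> \<open>By acyclicity \<open>Y\<close> is not its own ancestor, so each factor in
        the positivity condition is a factor of the nonzero weight.\<close>
      then show "edge_factor C p \<pi> A a a' j x \<noteq> 0" using nz Yntc by auto
    qed
    moreover have "v \<in> space (PiM (- {Y}) (state C))"
      using x a \<open>A \<noteq> Y\<close> by (auto simp: v_def edge_setting_def space_PiM PiE_iff extensional_def)
    ultimately have "(\<integral>\<^sup>+ y. cond_dens (state C) p Y (pa C Y) (v(Y := y)) \<partial>state C Y) = 1"
      using Ynpa by (intro nn_integral_cond_dens[OF sf p, where J = "- {Y}"]) auto
    moreover have "?F (x(Y := y)) = cond_dens (state C) p Y (pa C Y) (v(Y := y))" for y
      using \<open>A \<noteq> Y\<close> by (simp add: edge_factor_def v_def edge_setting_def fun_upd_twist)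
    ultimately have "(\<integral>\<^sup>+ y. ?F (x(Y := y)) \<partial>state C Y) = 1" by simp
    then show ?thesis
      by (subst nn_integral_multc) (auto intro: measurable_compose[OF upd[OF x] F])
  qed simp
  have "(\<integral>\<^sup>+ y. edge_g C p \<pi> A Y a a' y \<partial>state C Y)
      = (\<integral>\<^sup>+ y. \<integral>\<^sup>+ x. ?F (x(Y := y)) * ?W (x(Y := y)) \<partial>?N \<partial>state C Y)"
    using g_formula_outcome_factor[OF \<open>A \<noteq> Y\<close> terminal,
        where h = ?F and p = p and \<pi> = \<pi> and a = a and a' = a']
    by (simp add: edge_g_def W)
  \<comment> \<open>The integrals are swapped by passing through the product over
    \<open>insert Y (- {A, Y})\<close>.\<close>
  also have "\<dots> = (\<integral>\<^sup>+ x. ?F x * ?W x \<partial>PiM (insert Y (- {A, Y})) (state C))"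
    by (rule product_nn_integral_insert_rev[OF _ _ meas, symmetric]) auto
  also have "\<dots> = (\<integral>\<^sup>+ x. \<integral>\<^sup>+ y. ?F (x(Y := y)) * ?W (x(Y := y)) \<partial>state C Y \<partial>?N)"
    by (rule product_nn_integral_insert[OF _ _ meas]) auto
  also have "\<dots> = (\<integral>\<^sup>+ x. ?W x \<partial>?N)"
    by (intro nn_integral_cong) (simp add: W inner)
  finally show ?thesis .
qed

text \<open>Identification enters through the mass: a density of a random variable on a probability
  space integrates to one, so the weight does too. Any \<open>V\<close> with density
  \<open>edge_g\<close> serves.\<close>

lemma path_mean0_eq_cond_mean:
  fixes C :: "('i::finite, 'v, 'e, 'w) causal_model"
  assumes model: "scm C"
    and p: "p \<in> borel_measurable (PiM UNIV (state C))"
    and a: "a \<in> space (state C A)" "a' \<in> space (state C A)"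
    and terminal: "\<And>i. i \<noteq> Y \<Longrightarrow> Y \<notin> pa C i"
    and "A \<noteq> Y"
    and defd: "edge_factors_defined C p \<pi> A Y a a'"
    and ident: "distributed (prob C) (state C Y) V (edge_g C p \<pi> A Y a a')"
  shows "path_mean0 C p \<pi> A Y yv z0 a a' = cond_mean (state C) p Y yv (z0(A := a))"
proof -
  let ?W = "edge_weight C p \<pi> A Y a a'" and ?N = "PiM (- {A, Y}) (state C)"
  let ?h = "\<lambda>v. cond_dens (state C) p Y (- {Y}) (z0(A := a, Y := v Y))"
  have sf: "sigma_finite_measure (state C i)" for i
    using model by (simp add: scm_def)
  interpret prob_space "prob C" using model by (simp add: scm_def)
  interpret Q: prob_space "density (state C Y) (edge_g C p \<pi> A Y a a')"
    using prob_space_distr[OF distributed_measurable[OF ident]] distributed_distr_eq_density[OF ident]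
    by simp
  have "(\<integral>\<^sup>+ y. edge_g C p \<pi> A Y a a' y \<partial>state C Y) = 1"
    using Q.emeasure_space_1 distributed_borel_measurable[OF ident]
    by (simp add: emeasure_density cong: nn_integral_cong)
  then have mass: "(\<integral>\<^sup>+ x. ?W x \<partial>?N) = 1"
    by (simp add: nn_integral_edge_g[OF model p a terminal \<open>A \<noteq> Y\<close> defd])
  have "edge_g0 C p \<pi> A Y z0 a a' y = cond_dens (state C) p Y (- {Y}) (z0(A := a, Y := y))"
    if y: "y \<in> space (state C Y)" for y
  proof -
    have "edge_g0 C p \<pi> A Y z0 a a' y
        = (\<integral>\<^sup>+ x. cond_dens (state C) p Y (- {Y}) (z0(A := a, Y := y)) * ?W x \<partial>?N)"
      using g_formula_outcome_factor[OF \<open>A \<noteq> Y\<close> terminal, where h = ?h] by (simp add: edge_g0_def)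
    also have "\<dots> = cond_dens (state C) p Y (- {Y}) (z0(A := a, Y := y)) * (\<integral>\<^sup>+ x. ?W x \<partial>?N)"
      by (rule nn_integral_cmult)
        (rule borel_measurable_edge_weight[OF sf p a terminal \<open>A \<noteq> Y\<close> y])
    finally show ?thesis by (simp add: mass)
  qed
  \<comment> \<open>The two densities are known to agree on \<open>space (state C Y)\<close>;
    unfolding \<open>density_def\<close> reduces equality of the measures to integrals over that
    space.\<close>
  then have "density (state C Y) (edge_g0 C p \<pi> A Y z0 a a')
      = outcome_cond (state C) p Y (z0(A := a))"
    by (auto simp: outcome_cond_def density_def intro!: arg_cong2[where f = "measure_of _"] nn_integral_cong)
  then show ?thesis by (simp add: path_mean0_def cond_mean_def)
qed

section \<open>Existence and uniqueness of the coefficients\<close>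

theorem theorem2:
  fixes C :: "('i::finite, 'v, 'e, 'w) causal_model"
    and A Y :: 'i and X M :: "'i set"
    and trt :: "real \<Rightarrow> 'v" and yv :: "'v \<Rightarrow> real"
    and p :: "('i \<Rightarrow> 'v) \<Rightarrow> ennreal"
    and \<pi> :: "'i list set" and z0 :: "'i \<Rightarrow> 'v" and a' :: real
  assumes model: "scm C"
    and joint_density: "distributed (prob C) (PiM UNIV (state C)) (observed C) p"
    and partition: "X \<union> {A} \<union> M = - {Y}" "A \<notin> X" "A \<notin> M" "X \<inter> M = {}"
    and pre_treatment: "\<forall>i\<in>X. (A, i) \<notin> (edges C)\<^sup>+"
    and post_treatment: "\<forall>i\<in>M. (i, A) \<notin> (edges C)\<^sup>+"
    and pre_outcome: "\<forall>i\<in>- {Y}. (Y, i) \<notin> (edges C)\<^sup>+"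
    and binary_treatment: "inj_on trt {0, 1}" "state C A = count_space (trt ` {0, 1})"
    and real_outcome: "yv \<in> borel_measurable (state C Y)"
    and paths: "\<forall>q\<in>\<pi>. proper_causal_path (edges C) A Y q"
    and direct_edge: "[A, Y] \<in> \<pi>"
    and reference: "a' \<in> {0, 1}" "z0 \<in> space (PiM (- {A, Y}) (state C))"
    and consistent: "edge_consistent (edges C) \<pi> A Y"
    and factors_defined:
      "\<forall>a\<in>{0, 1}. edge_factors_defined C p \<pi> A Y (trt a) (trt a')"
    and identified:
      "\<forall>a\<in>{0, 1}. distributed (prob C) (state C Y)
         (\<lambda>\<omega>. path_outcome C \<pi> A (trt a) (trt a') \<omega> Y) (edge_g C p \<pi> A Y (trt a) (trt a'))"
    and finite_path_mean:
      "\<forall>a\<in>{0, 1}. integrable (prob C) (\<lambda>\<omega>. yv (path_outcome C \<pi> A (trt a) (trt a') \<omega> Y))"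
    and reference_mean_defined:
      "\<forall>a\<in>{0, 1}. cond_mean_defined (state C) p Y yv (z0(A := trt a))"
  shows
    "let EY = cond_mean (state C) p Y yv;
         f = (\<lambda>z. EY z - EY (z0(A := z A)));
         EY\<pi> = (\<lambda>a. path_mean C \<pi> A Y yv (trt a) (trt a'));
         EY\<pi>0 = (\<lambda>a. path_mean0 C p \<pi> A Y yv z0 (trt a) (trt a'));
         decomposition = (\<lambda>w\<^sub>0 w\<^sub>a :: real.
           \<forall>z \<in> space (PiM (- {Y}) (state C)). \<forall>a \<in> {0, 1}.
             cond_mean_defined (state C) p Y yv z \<and> z A = trt a \<longrightarrow>
             EY z = f z - (EY\<pi> a - EY\<pi>0 a) + (w\<^sub>0 + w\<^sub>a * a))
     in (\<exists>w\<^sub>0 w\<^sub>a. decomposition w\<^sub>0 w\<^sub>a) \<and>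
        (\<forall>w\<^sub>0 w\<^sub>a. decomposition w\<^sub>0 w\<^sub>a \<longrightarrow> w\<^sub>a = EY\<pi> 1 - EY\<pi> 0)"
proof -
  have AY: "A \<noteq> Y" using partition(1) by auto
  have terminal: "Y \<notin> pa C i" if "i \<noteq> Y" for i
    using pre_outcome that by (auto simp: pa_def)
  have p: "p \<in> borel_measurable (PiM UNIV (state C))"
    using distributed_borel_measurable[OF joint_density] by simp
  have trt: "trt a \<in> space (state C A)" if "a \<in> {0, 1}" for a
    using that binary_treatment(2) by auto
  have ref: "path_mean0 C p \<pi> A Y yv z0 (trt a) (trt a')
      = cond_mean (state C) p Y yv (z0(A := trt a))" if "a \<in> {0, 1}" for a
    using path_mean0_eq_cond_mean[OF model p trt[OF that] trt[OF reference(1)] terminal AY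
        factors_defined[rule_format, OF that] identified[rule_format, OF that]] .
  have z0: "z0(A := trt a) \<in> space (PiM (- {Y}) (state C))" if "a \<in> {0, 1}" for a
    using reference(2) trt[OF that] AY by (auto simp: space_PiM PiE_iff extensional_def)
  define D where "D w\<^sub>0 w\<^sub>a \<longleftrightarrow>
      (\<forall>z \<in> space (PiM (- {Y}) (state C)). \<forall>a \<in> {0, 1}.
         cond_mean_defined (state C) p Y yv z \<and> z A = trt a \<longrightarrow>
         cond_mean (state C) p Y yv z =
         (cond_mean (state C) p Y yv z - cond_mean (state C) p Y yv (z0(A := z A))) -
         (path_mean C \<pi> A Y yv (trt a) (trt a') - path_mean0 C p \<pi> A Y yv z0 (trt a) (trt a')) +
         (w\<^sub>0 + w\<^sub>a * a))" for w\<^sub>0 w\<^sub>a :: real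
  \<comment> \<open>By \<open>ref\<close> the reference mean inside \<open>f\<close> cancels against
    the mean of the modified functional, and the conditional mean at \<open>z\<close> stands on both
    sides; no dependence on \<open>z\<close> beyond \<open>a\<close> remains.\<close>
  have D: "D w\<^sub>0 w\<^sub>a \<longleftrightarrow> (\<forall>a\<in>{0, 1}. w\<^sub>0 + w\<^sub>a * a = path_mean C \<pi> A Y yv (trt a) (trt a'))"
    (is "_ \<longleftrightarrow> ?R") for w\<^sub>0 w\<^sub>a
  proof
    assume "D w\<^sub>0 w\<^sub>a"
    show ?R
    proof
      fix a :: real assume a: "a \<in> {0, 1}"
      \<comment> \<open>To extract the equation for \<open>a\<close>, the decomposition must hold at
        some actual point: the reference point with treatment \<open>trt a\<close> is one.\<close>
      have "cond_mean_defined (state C) p Y yv (z0(A := trt a))"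
        using reference_mean_defined a by blast
      with \<open>D w\<^sub>0 w\<^sub>a\<close>[unfolded D_def, rule_format, OF z0[OF a] a] ref[OF a]
      show "w\<^sub>0 + w\<^sub>a * a = path_mean C \<pi> A Y yv (trt a) (trt a')" by simp
    qed
  next
    assume ?R
    then show "D w\<^sub>0 w\<^sub>a" unfolding D_def using ref by simp
  qed
  \<comment> \<open>The equations for \<open>a = 0\<close> and \<open>a = 1\<close> form a linear
    system with exactly one solution: the first gives the intercept, their difference the
    slope.\<close>
  have "D (path_mean C \<pi> A Y yv (trt 0) (trt a'))
      (path_mean C \<pi> A Y yv (trt 1) (trt a') - path_mean C \<pi> A Y yv (trt 0) (trt a'))"
    by (simp add: D)
  moreover have "w\<^sub>a = path_mean C \<pi> A Y yv (trt 1) (trt a') - path_mean C \<pi> A Y yv (trt 0) (trt a')"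
    if "D w\<^sub>0 w\<^sub>a" for w\<^sub>0 w\<^sub>a
    using that by (simp add: D)
  ultimately show ?thesis unfolding Let_def D_def by blast
qed

end
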